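(* Let $M\ge1$ be an integer and set $$e_j^{[M]}(t):=e_j(1,t,\ldots,t^{M-1})=t^{\binom j2}\begin{bmatrix} M \\ j \end{bmatrix}_t,\qquad 0\le j\le M.$$ Then for every $m\ge0$ the coefficients $f_m^{[M]}(t)$ satisfy $$\sum_{j=0}^{\min(M,m)}e_j^{[M]}(t)\,f_{m-j}^{[M]}(t)=\begin{cases}(-1)^m e_m^{[M]}(t),&0\le m\le M,\\ 0,&m>M.\end{cases}$$ In particular, for $m>M$, $$f_m^{[M]}(t)=-\sum_{j=1}^{M}e_j^{[M]}(t)\,f_{m-j}^{[M]}(t).$$
   Context: Let $t$ be an indeterminate. The coefficients $f_m^{[M]}(t)$ are defined by $F_{t,t^M}(u)=\sum_{m\ge0}f_m^{[M]}(t)u^m$, where $$F_{t,s}(u)=\exp\Big(-2\sum_{n\ge1,\ n\text{ odd}}\frac{1-s^n}{1-t^n}\frac{u^n}{n}\Big)$$ as a formal power series in $u$. Here $e_j$ is the $j$th elementary symmetric polynomial and $\begin{bmatrix} n \\ k \end{bmatrix}_t$ is the Gaussian binomial coefficient in $t$. *)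

theory Defs
  imports "HOL-Computational_Algebra.Computational_Algebra"
begin

text \<open>The library makes fraction fields of characteristic zero only in the linearly ordered
  case. The instances below cover \<open>K(t)\<close>, i.e. \<^typ>\<open>'a poly fract\<close>, for every field \<open>K\<close> of
  characteristic zero.\<close>

instance fract :: ("{idom,ring_char_0}") ring_char_0
proof
  show "inj (of_nat :: nat \<Rightarrow> 'a fract)"
    by (rule injI) (simp add: of_nat_fract eq_fract)
qed

instance fract :: ("{idom,ring_char_0}") field_char_0 ..

definition indet :: "'a :: field_char_0 poly fract" where
  "indet = Fract [:0, 1:] 1"

definition elem_sym :: "'i set \<Rightarrow> ('i \<Rightarrow> 'a :: comm_semiring_1) \<Rightarrow> nat \<Rightarrow> 'a" where
  "elem_sym I x j = (\<Sum>S | S \<subseteq> I \<and> card S = j. \<Prod>i\<in>S. x i)"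

text \<open>For \<open>k > n\<close> the factor with \<open>i = n\<close> is zero, so the product vanishes as it should. The
  formula is only meaningful if \<open>t\<close> is not a root of unity of order at most \<open>k\<close>, since division
  by zero yields zero.\<close>

definition gauss_binomial :: "'a :: field \<Rightarrow> nat \<Rightarrow> nat \<Rightarrow> 'a" where
  "gauss_binomial t n k = (\<Prod>i<k. (1 - t ^ (n - i)) / (1 - t ^ (i + 1)))"

text \<open>The exponent has zero constant coefficient (\<open>0\<close> is even), so its composition with the
  exponential series is the usual exponential of a formal power series. As above, \<open>t\<close> must not be
  a root of unity (of odd order).\<close>

definition F_series :: "'a :: field_char_0 \<Rightarrow> 'a \<Rightarrow> 'a fps" where
  "F_series t s = fps_exp 1 oo
     (- 2 * Abs_fps (\<lambda>n. if odd n then (1 - s ^ n) / (1 - t ^ n) * (1 / of_nat n) else 0))"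

definition f_coeff :: "nat \<Rightarrow> nat \<Rightarrow> 'a :: field_char_0 poly fract" where
  "f_coeff M m = fps_nth (F_series indet (indet ^ M)) m"

definition e_coeff :: "nat \<Rightarrow> nat \<Rightarrow> 'a :: field_char_0 poly fract" where
  "e_coeff M j = elem_sym {..<M} (\<lambda>i. indet ^ i) j"

end

theory Submission
  imports Defs
begin

text \<open>Write \<open>P(u) = (1 + u)(1 + t u) \<cdots> (1 + t\<^sup>M\<^sup>-\<^sup>1 u)\<close>, whose coefficients are the
  elementary symmetric polynomials \<open>e\<^sub>j(1, t, \<dots>, t\<^sup>M\<^sup>-\<^sup>1)\<close>. All three claims are readings of
  two identities.

  The recurrence is the coefficient form of \<open>P(u) F(u) = P(-u)\<close>, where \<open>F\<close> is the series at
  \<open>s = t\<^sup>M\<close>. Because \<open>(1 - t\<^sup>M\<^sup>n) / (1 - t\<^sup>n)\<close> is the power sum \<open>\<Sum>\<^sub>i t\<^sup>i\<^sup>n\<close>, the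
  logarithm of \<open>F\<close> is the sum over \<open>i\<close> of \<open>log ((1 - t\<^sup>i u) / (1 + t\<^sup>i u))\<close>. Logarithms are
  avoided by comparing logarithmic derivatives: those of \<open>F\<close> and of \<open>P(-u) / P(u)\<close>
  agree (lemma \<open>log_deriv_prod\<close>), and both series have constant coefficient 1
  (lemma \<open>fps_eq_if_log_deriv_eq\<close>).

  The closed form of \<open>e\<^sub>j\<close> comes from \<open>(1 + t\<^sup>M u) P(u) = (1 + u) P(t u)\<close>. Its coefficients
  give \<open>e\<^sub>j\<^sub>+\<^sub>1 = t\<^sup>j (1 - t\<^sup>M\<^sup>-\<^sup>j) / (1 - t\<^sup>j\<^sup>+\<^sup>1) e\<^sub>j\<close>: the power \<open>t\<^sup>j\<close> turns the exponent
  \<open>j choose 2\<close> into \<open>Suc j choose 2\<close>, and the quotient is the next factor of the product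
  formula for the Gaussian binomial coefficient. The arguments work for every
  \<open>t\<close> in a field of characteristic zero that is not a root of unity.\<close>

section \<open>Elementary symmetric polynomials\<close>

lemma prod_one_plus_eq_elem_sym:
  fixes x :: "'i \<Rightarrow> 'a :: comm_ring_1"
  assumes "finite I"
  shows "(\<Prod>i\<in>I. 1 + fps_const (x i) * fps_X) = Abs_fps (elem_sym I x)"
proof (rule fps_ext)
  fix n
  have "(\<Prod>i\<in>I. 1 + fps_const (x i) * fps_X)
      = (\<Sum>S\<in>Pow I. \<Prod>i\<in>S. fps_const (x i) * fps_X)"
    using prod_add[OF assms, of "\<lambda>i. fps_const (x i) * fps_X" "\<lambda>_. 1"]
    by (simp add: add.commute)
  also have "\<dots> = (\<Sum>S\<in>Pow I. fps_const (\<Prod>i\<in>S. x i) * fps_X ^ card S)"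
  proof (rule sum.cong)
    fix S assume "S \<in> Pow I"
    have "(\<Prod>i\<in>S. fps_const (x i)) = fps_const (\<Prod>i\<in>S. x i)"
      by (induction S rule: infinite_finite_induct) auto
    then show "(\<Prod>i\<in>S. fps_const (x i) * fps_X) = fps_const (\<Prod>i\<in>S. x i) * fps_X ^ card S"
      by (simp add: prod.distrib)
  qed simp
  finally have "fps_nth (\<Prod>i\<in>I. 1 + fps_const (x i) * fps_X) n
      = (\<Sum>S\<in>Pow I. if n = card S then \<Prod>i\<in>S. x i else 0)"
    by (auto simp: fps_sum_nth intro!: sum.cong)
  also have "\<dots> = (\<Sum>S | S \<subseteq> I \<and> card S = n. \<Prod>i\<in>S. x i)"
    using assms by (intro sum.mono_neutral_cong_right) auto
  finally show "fps_nth (\<Prod>i\<in>I. 1 + fps_const (x i) * fps_X) n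
      = fps_nth (Abs_fps (elem_sym I x)) n"
    by (simp add: elem_sym_def)
qed

lemma elem_sym_scale:
  "elem_sym I (\<lambda>i. c * x i) = (\<lambda>j. c ^ j * elem_sym I x j)"
  unfolding elem_sym_def sum_distrib_left
  by (intro ext sum.cong) (auto simp: prod.distrib)

lemma elem_sym_0:
  assumes "finite I"
  shows "elem_sym I x 0 = 1"
proof -
  have "{S. S \<subseteq> I \<and> card S = 0} = {{}}"
    using finite_subset[OF _ assms] by auto
  then show ?thesis by (simp add: elem_sym_def)
qed

lemma elem_sym_eq_0:
  assumes "finite I" "card I < j"
  shows "elem_sym I x j = 0"
proof -
  have "{S. S \<subseteq> I \<and> card S = j} = {}"
    using card_mono[OF assms(1)] assms(2) by (auto simp: not_less[symmetric])
  then show ?thesis by (simp only: elem_sym_def sum.empty)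
qed

text \<open>Coefficient \<open>j + 1\<close> of \<open>(1 + t\<^sup>M u) P(u) = (1 + u) P(t u)\<close>; both sides are the product
  of \<open>1 + t\<^sup>i u\<close> over \<open>i \<le> M\<close>.\<close>

lemma elem_sym_geometric_Suc:
  fixes t :: "'a :: comm_ring_1"
  shows "elem_sym {..<M} (\<lambda>i. t ^ i) (Suc j) + t ^ M * elem_sym {..<M} (\<lambda>i. t ^ i) j
       = t ^ Suc j * elem_sym {..<M} (\<lambda>i. t ^ i) (Suc j)
         + t ^ j * elem_sym {..<M} (\<lambda>i. t ^ i) j"
proof -
  let ?e = "elem_sym {..<M} (\<lambda>i. t ^ i)"
  have "Abs_fps ?e * (1 + fps_const (t ^ M) * fps_X)
      = (\<Prod>i<Suc M. 1 + fps_const (t ^ i) * fps_X)"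
    by (simp add: prod_one_plus_eq_elem_sym[symmetric])
  also have "\<dots> = (1 + fps_X) * (\<Prod>i<M. 1 + fps_const (t * t ^ i) * fps_X)"
    by (subst prod.lessThan_Suc_shift) simp
  also have "\<dots> = (1 + fps_X) * Abs_fps (\<lambda>j. t ^ j * ?e j)"
    using prod_one_plus_eq_elem_sym[of "{..<M}" "\<lambda>i. t * t ^ i"]
    by (simp add: elem_sym_scale)
  finally have "fps_nth (Abs_fps ?e + fps_const (t ^ M) * (fps_X * Abs_fps ?e)) (Suc j)
      = fps_nth (Abs_fps (\<lambda>j. t ^ j * ?e j) + fps_X * Abs_fps (\<lambda>j. t ^ j * ?e j)) (Suc j)"
    by (simp only: algebra_simps mult_1_left)
  then show ?thesis by simp
qed

lemma elem_sym_geometric_eq_gauss_binomial: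
  fixes t :: "'a :: field"
  assumes t: "\<And>n. n > 0 \<Longrightarrow> t ^ n \<noteq> 1" and "j \<le> M"
  shows "elem_sym {..<M} (\<lambda>i. t ^ i) j = t ^ (j choose 2) * gauss_binomial t M j"
  using \<open>j \<le> M\<close>
proof (induction j)
  case 0
  then show ?case by (simp add: elem_sym_0 gauss_binomial_def binomial_eq_0)
next
  case (Suc j)
  let ?e = "elem_sym {..<M} (\<lambda>i. t ^ i)"
  have nz: "1 - t ^ Suc j \<noteq> 0" using t[of "Suc j"] by auto
  have "t ^ M = t ^ j * t ^ (M - j)"
    using Suc.prems by (simp flip: power_add)
  with elem_sym_geometric_Suc[of M t j]
  have "?e (Suc j) * (1 - t ^ Suc j) = t ^ j * (1 - t ^ (M - j)) * ?e j"
    by (simp add: algebra_simps)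
  then have "?e (Suc j) = t ^ j * ((1 - t ^ (M - j)) / (1 - t ^ Suc j)) * ?e j"
    using nz by (simp add: field_simps)
  also have "\<dots> = t ^ (j + (j choose 2)) * gauss_binomial t M (Suc j)"
    using Suc by (simp add: gauss_binomial_def power_add)
  also have "j + (j choose 2) = Suc j choose 2"
    by (simp add: numeral_2_eq_2)
  finally show ?case .
qed

section \<open>The series as a ratio of products\<close>

text \<open>The sum on the left is the logarithmic derivative of \<open>\<Prod>\<^sub>i (1 - x\<^sub>i u) / (1 + x\<^sub>i u)\<close>:
  each summand is the expansion of \<open>-2 x\<^sub>i / (1 - x\<^sub>i\<^sup>2 u\<^sup>2)\<close>.\<close>

lemma log_deriv_prod:
  fixes x :: "'i \<Rightarrow> 'a :: field_char_0"
  assumes "finite I"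
  defines "R \<equiv> \<lambda>y. Abs_fps (\<lambda>n. if even n then - 2 * y ^ Suc n else 0)"
  defines "p \<equiv> \<lambda>y. 1 + fps_const y * fps_X"
  shows "(\<Sum>i\<in>I. R (x i)) * (\<Prod>i\<in>I. p (x i)) * (\<Prod>i\<in>I. p (- x i))
       = fps_deriv (\<Prod>i\<in>I. p (- x i)) * (\<Prod>i\<in>I. p (x i))
         - fps_deriv (\<Prod>i\<in>I. p (x i)) * (\<Prod>i\<in>I. p (- x i))"
  using assms(1)
proof (induction I rule: finite_induct)
  case empty
  show ?case by simp
next
  case (insert k I)
  let ?P = "\<Prod>i\<in>I. p (x i)" and ?Q = "\<Prod>i\<in>I. p (- x i)"
  let ?a = "p (x k)" and ?b = "p (- x k)" and ?c = "fps_const (x k)"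
  \<comment> \<open>The geometric series identity \<open>(1 - x\<^sub>k\<^sup>2 u\<^sup>2) R(x\<^sub>k) = -2 x\<^sub>k\<close>.\<close>
  have "R (x k) - fps_const (x k * x k) * (R (x k) * fps_X ^ 2) = - 2 * ?c"
  proof (rule fps_ext)
    fix n :: nat
    consider "n = 0" | "n = 1" | m where "n = m + 2"
      by (metis One_nat_def Suc_1 add.commute add_Suc_shift not0_implies_Suc plus_1_eq_Suc add_0)
    then show "fps_nth (R (x k) - fps_const (x k * x k) * (R (x k) * fps_X ^ 2)) n
        = fps_nth (- 2 * ?c) n"
      by cases (simp_all add: R_def fps_X_power_mult_right_nth
        numeral_fps_const)
  qed
  moreover have "?a * ?b = 1 - fps_const (x k * x k) * fps_X ^ 2"
    by (simp add: p_def algebra_simps power2_eq_square flip: fps_const_neg)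
  ultimately have R: "R (x k) * ?a * ?b = - 2 * ?c"
    by (simp only: mult.assoc) (simp add: right_diff_distrib mult.left_commute)
  have da: "fps_deriv ?a = ?c" and db: "fps_deriv ?b = - ?c"
    by (simp_all add: p_def)
  have ab: "?a + ?b = 2"
    by (simp add: p_def algebra_simps flip: fps_const_neg)
  have "(\<Sum>i\<in>insert k I. R (x i)) * (\<Prod>i\<in>insert k I. p (x i)) * (\<Prod>i\<in>insert k I. p (- x i))
      = (R (x k) * ?a * ?b) * (?P * ?Q) + ?a * ?b * ((\<Sum>i\<in>I. R (x i)) * ?P * ?Q)"
    using insert.hyps by (simp add: algebra_simps)
  also have "\<dots> = - ((?a + ?b) * ?c) * (?P * ?Q)
      + ?a * ?b * (fps_deriv ?Q * ?P - fps_deriv ?P * ?Q)"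
    unfolding R insert.IH ab by simp
  also have "\<dots> = (fps_deriv ?b * ?Q + ?b * fps_deriv ?Q) * (?a * ?P)
      - (fps_deriv ?a * ?P + ?a * fps_deriv ?P) * (?b * ?Q)"
    unfolding da db by (simp add: algebra_simps flip: fps_const_neg)
  also have "\<dots> = fps_deriv (?b * ?Q) * (?a * ?P) - fps_deriv (?a * ?P) * (?b * ?Q)"
    by (simp add: add.commute)
  finally show ?case
    using insert.hyps by simp
qed

lemma fps_eq_if_log_deriv_eq:
  fixes F G :: "'a :: field_char_0 fps"
  assumes "fps_deriv F * G = F * fps_deriv G"
    and F0: "fps_nth F 0 = 1" and G0: "fps_nth G 0 = 1"
  shows "F = G"
proof -
  have "fps_deriv (F * inverse G)
      = (fps_deriv F * G - F * fps_deriv G) * inverse G ^ 2"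
  proof -
    have "fps_deriv F * inverse G = fps_deriv F * (G * inverse G) * inverse G"
      using inverse_mult_eq_1[of G] G0 by (simp add: mult.commute)
    then show ?thesis
      using G0 by (simp add: fps_inverse_deriv algebra_simps power2_eq_square)
  qed
  also have "\<dots> = 0" using assms(1) by simp
  finally have "F * inverse G = fps_const (fps_nth (F * inverse G) 0)"
    by (rule fps_deriv_eq_0_iff[THEN iffD1])
  then have "F * inverse G = 1" using F0 G0 by simp
  then have "F * (inverse G * G) = G" by (simp flip: mult.assoc)
  then show ?thesis using inverse_mult_eq_1[of G] G0 by simp
qed

lemma F_series_times_prod:
  fixes t :: "'a :: field_char_0"
  assumes t: "\<And>n. n > 0 \<Longrightarrow> t ^ n \<noteq> 1"
  shows "(\<Prod>i<M. 1 + fps_const (t ^ i) * fps_X) * F_series t (t ^ M)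
       = (\<Prod>i<M. 1 + fps_const (- (t ^ i)) * fps_X)"
proof -
  define p :: "'a \<Rightarrow> 'a fps" where "p = (\<lambda>y. 1 + fps_const y * fps_X)"
  define R :: "'a \<Rightarrow> 'a fps"
    where "R = (\<lambda>y. Abs_fps (\<lambda>n. if even n then - 2 * y ^ Suc n else 0))"
  define E where "E = - 2 * Abs_fps (\<lambda>n. if odd n
    then (1 - (t ^ M) ^ n) / (1 - t ^ n) * (1 / of_nat n) else 0)"
  let ?F = "F_series t (t ^ M)"
  let ?P = "\<Prod>i<M. p (t ^ i)" and ?Q = "\<Prod>i<M. p (- (t ^ i))"
  have E_nth: "fps_nth E n = - 2 * (if odd n
    then (1 - (t ^ M) ^ n) / (1 - t ^ n) * (1 / of_nat n) else 0)" for n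
    by (simp add: E_def numeral_fps_const)
  have F: "?F = fps_exp 1 oo E" by (simp add: F_series_def E_def)
  have "fps_deriv E = (\<Sum>i<M. R (t ^ i))"
  proof (rule fps_ext)
    fix n
    have "(\<Sum>i<M. (t ^ Suc n) ^ i) = (1 - (t ^ Suc n) ^ M) / (1 - t ^ Suc n)"
      using t[of "Suc n"] by (subst sum_gp_strict) auto
    then have "(1 - (t ^ M) ^ Suc n) / (1 - t ^ Suc n) = (\<Sum>i<M. (t ^ i) ^ Suc n)"
      by (simp only: mult.commute flip: power_mult)
    moreover have "fps_nth (fps_deriv E) n
        = (if even n then - 2 * ((1 - (t ^ M) ^ Suc n) / (1 - t ^ Suc n)) else 0)"
    proof (cases "even n")
      case True
      have "of_nat (Suc n) * (- 2 * (q * (1 / of_nat (Suc n)))) = - 2 * q" for q :: 'a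
        by (simp del: of_nat_Suc)
      with True show ?thesis
        by (simp only: fps_deriv_nth E_nth even_Suc not_not if_True flip: Suc_eq_plus1)
    next
      case False
      then show ?thesis by (simp add: E_nth)
    qed
    ultimately show "fps_nth (fps_deriv E) n = fps_nth (\<Sum>i<M. R (t ^ i)) n"
      by (simp only:) (simp add: R_def fps_sum_nth sum_distrib_left sum_negf del: power_Suc)
  qed
  then have log_deriv: "fps_deriv E * ?P * ?Q = fps_deriv ?Q * ?P - fps_deriv ?P * ?Q"
    using log_deriv_prod[of "{..<M}" "\<lambda>i. t ^ i"] by (simp add: R_def p_def)
  have dF: "fps_deriv ?F = ?F * fps_deriv E"
    unfolding F by (subst fps_compose_deriv) (simp_all add: E_nth)
  have "fps_deriv (?P * ?F) * ?Q
      = ?F * (fps_deriv E * ?P * ?Q + fps_deriv ?P * ?Q)"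
    by (simp add: dF algebra_simps)
  also have "\<dots> = (?P * ?F) * fps_deriv ?Q"
    unfolding log_deriv by (simp add: algebra_simps)
  finally have "?P * ?F = ?Q"
  proof (rule fps_eq_if_log_deriv_eq)
    have P0: "fps_nth (\<Prod>i<k. p (g i)) 0 = 1" for g :: "nat \<Rightarrow> 'a" and k
      by (induction k) (simp_all add: p_def)
    show "fps_nth (?P * ?F) 0 = 1" by (simp add: P0 F)
    show "fps_nth ?Q 0 = 1" by (rule P0)
  qed
  then show ?thesis by (simp add: p_def)
qed

section \<open>The recurrence over the rational function field\<close>

lemma indet_power_neq_1:
  assumes "n > 0"
  shows "(indet :: 'a :: field_char_0 poly fract) ^ n \<noteq> 1"
proof
  assume eq: "(indet :: 'a poly fract) ^ n = 1"
  have "(indet :: 'a poly fract) ^ k = Fract ([:0, 1:] ^ k) 1" for k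
    by (induction k) (simp_all add: indet_def One_fract_def)
  with eq have "[:0, 1:] ^ n = (1 :: 'a poly)"
    by (simp add: One_fract_def eq_fract)
  then have "poly ([:0, 1:] ^ n) 0 = (1 :: 'a)" by simp
  with assms show False by (simp add: power_0_left)
qed

lemma sum_e_coeff_f_coeff:
  "(\<Sum>j = 0..min M m. e_coeff M j * (f_coeff M (m - j) :: 'a :: field_char_0 poly fract))
     = (if m \<le> M then (- 1) ^ m * e_coeff M m else 0)"
proof -
  let ?x = "\<lambda>i. indet ^ i :: 'a poly fract"
  have e0: "(e_coeff M j :: 'a poly fract) = 0" if "j > M" for j
    using that by (simp add: e_coeff_def elem_sym_eq_0)
  have "Abs_fps (elem_sym {..<M} ?x) * F_series indet (indet ^ M)
      = Abs_fps (elem_sym {..<M} (\<lambda>i. - 1 * ?x i))"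
    using F_series_times_prod[OF indet_power_neq_1, where M = M]
    by (simp add: prod_one_plus_eq_elem_sym[symmetric])
  then have "fps_nth (Abs_fps (elem_sym {..<M} ?x) * F_series indet (indet ^ M)) m
      = (- 1) ^ m * e_coeff M m"
    by (simp only: elem_sym_scale e_coeff_def fps_nth_Abs_fps)
  then have "(\<Sum>j = 0..m. e_coeff M j * (f_coeff M (m - j) :: 'a poly fract))
      = (- 1) ^ m * e_coeff M m"
    by (simp add: fps_mult_nth e_coeff_def f_coeff_def)
  moreover have "(\<Sum>j = 0..min M m. e_coeff M j * (f_coeff M (m - j) :: 'a poly fract))
      = (\<Sum>j = 0..m. e_coeff M j * f_coeff M (m - j))"
    by (rule sum.mono_neutral_left) (auto simp: e0)
  ultimately show ?thesis by (simp add: e0)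
qed

theorem proposition4p4:
  fixes M :: nat
  assumes "M \<ge> 1"
  shows "(\<forall>j\<le>M. (e_coeff M j :: 'a :: field_char_0 poly fract)
                = indet ^ (j choose 2) * gauss_binomial indet M j)
       \<and> (\<forall>m. (\<Sum>j = 0..min M m. e_coeff M j * (f_coeff M (m - j) :: 'a poly fract))
               = (if m \<le> M then (- 1) ^ m * e_coeff M m else 0))
       \<and> (\<forall>m>M. (f_coeff M m :: 'a poly fract)
               = - (\<Sum>j = 1..M. e_coeff M j * f_coeff M (m - j)))"
proof (intro conjI allI impI)
  fix j assume "j \<le> M"
  then show "(e_coeff M j :: 'a poly fract) = indet ^ (j choose 2) * gauss_binomial indet M j"
    unfolding e_coeff_def
    by (intro elem_sym_geometric_eq_gauss_binomial indet_power_neq_1)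
next
  fix m
  show "(\<Sum>j = 0..min M m. e_coeff M j * (f_coeff M (m - j) :: 'a poly fract))
      = (if m \<le> M then (- 1) ^ m * e_coeff M m else 0)"
    by (rule sum_e_coeff_f_coeff)
next
  fix m assume "m > M"
  then have "0 = (\<Sum>j = 0..M. e_coeff M j * (f_coeff M (m - j) :: 'a poly fract))"
    using sum_e_coeff_f_coeff[of M m, where 'a = 'a] by (simp add: min_def)
  also have "\<dots> = f_coeff M m + (\<Sum>j = 1..M. e_coeff M j * f_coeff M (m - j))"
    by (simp add: sum.atLeast_Suc_atMost e_coeff_def elem_sym_0)
  finally show "(f_coeff M m :: 'a poly fract) = - (\<Sum>j = 1..M. e_coeff M j * f_coeff M (m - j))"
    by (simp add: eq_neg_iff_add_eq_0)
qed

end
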